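(* Let $(M,\varphi)$ be any manifold with $G_2$-structure. Then every A-compatible contact structure on $(M,\varphi)$ determines a contact$-G_2-$structure on $M$.
   Context: A $G_2$-structure on a smooth $7$-manifold $M$ is a $3$-form $\varphi$ on $M$ such that for every $p\in M$ the pair $(T_pM,\varphi_p)$ is linearly isomorphic to $(\mathbb{R}^7,\varphi_0)$, where $\varphi_0=e^{123}+e^{145}+e^{167}+e^{246}-e^{257}-e^{347}-e^{356}$ and $e^{ijk}=dx_i\wedge dx_j\wedge dx_k$. A contact$-G_2-$structure on a smooth $7$-manifold $M$ is a quintuple $(\varphi,R,\alpha,f,g)$ where $\varphi$ is a $G_2$-structure, $R$ is a nowhere-zero vector field, $\alpha$ is a $1$-form on $M$, and $f,g:M\to\mathbb{R}$ are nowhere-zero smooth functions such that (i) $\alpha(R)=f$ and (ii) $d(g\,\alpha)=\iota_R\varphi$, where $\iota$ is the interior product. A contact form on a $(2n+1)$-dimensional manifold is a $1$-form $\alpha$ with $\alpha\wedge(d\alpha)^n$ nowhere zero. A co-oriented contact structure is a hyperplane distribution $\xi=\mathrm{Ker}(\alpha)$ for a global contact form $\alpha$; any such $\alpha$ is called a contact form for $\xi$. The Reeb vector field of a contact form $\alpha$ is the unique vector field $R$ with $\iota_R d\alpha=0$ and $\alpha(R)=1$. A co-oriented contact structure $\xi$ on $(M,\varphi)$ is A-compatible with $\varphi$ if there exist a vector field $R$ on $M$ and a nowhere-zero function $h:M\to\mathbb{R}$ such that $d\alpha=\iota_R\varphi$ for some contact form $\alpha$ for $\xi$, and $hR$ is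 the Reeb vector field of a contact form for $\xi$ (possibly different from $\alpha$). *)

theory Defs
  imports "HOL-Analysis.Analysis"
begin

section \<open>Smooth functions on open sets\<close>

text \<open>\<open>C_on n S f\<close> says that \<open>f\<close> is \<open>n\<close> times continuously differentiable on the open set \<open>S\<close>:
  the derivatives of the directional derivatives in every fixed direction are iterated.\<close>

primrec C_on :: "nat \<Rightarrow> 'a::real_normed_vector set \<Rightarrow> ('a \<Rightarrow> 'b::real_normed_vector) \<Rightarrow> bool" where
  "C_on 0 S f \<longleftrightarrow> continuous_on S f"
| "C_on (Suc n) S f \<longleftrightarrow>
     (\<forall>x\<in>S. f differentiable (at x)) \<and>
     (\<forall>v. C_on n S (\<lambda>x. frechet_derivative f (at x) v))"

definition smooth_on :: "'a::real_normed_vector set \<Rightarrow> ('a \<Rightarrow> 'b::real_normed_vector) \<Rightarrow> bool" where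
  "smooth_on S f \<longleftrightarrow> (\<forall>n. C_on n S f)"


section \<open>Smooth manifolds\<close>

text \<open>The manifold is the whole type \<open>'m\<close>, Hausdorff and second countable; its smooth structure is
  given by an atlas with values in the Euclidean space \<open>'e\<close>, which need not be maximal. A chart is
  a pair of its domain and the coordinate map (whose values outside the domain are irrelevant).\<close>

type_synonym ('m, 'e) chart = "'m set \<times> ('m \<Rightarrow> 'e)"

definition chart_inv :: "('m, 'e) chart \<Rightarrow> 'e \<Rightarrow> 'm" where
  "chart_inv c = inv_into (fst c) (snd c)"

definition smooth_atlas ::
  "('m::{t2_space, second_countable_topology}, 'e::euclidean_space) chart set \<Rightarrow> bool" where
  "smooth_atlas A \<longleftrightarrow>
     \<Union> (fst ` A) = UNIV \<and>
     (\<forall>c\<in>A. open (fst c) \<and> open (snd c ` fst c) \<and>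
            homeomorphism (fst c) (snd c ` fst c) (snd c) (chart_inv c)) \<and>
     (\<forall>c\<in>A. \<forall>d\<in>A. smooth_on (snd c ` (fst c \<inter> fst d)) (snd d \<circ> chart_inv c))"

definition smooth_function ::
  "('m, 'e::euclidean_space) chart set \<Rightarrow> ('m \<Rightarrow> real) \<Rightarrow> bool" where
  "smooth_function A f \<longleftrightarrow> (\<forall>c\<in>A. smooth_on (snd c ` fst c) (f \<circ> chart_inv c))"


section \<open>Tangent vectors and vector fields\<close>

text \<open>A tangent vector at \<open>p\<close> assigns to every chart around \<open>p\<close> a vector of coordinates, where the
  coordinates in two charts are related by the derivative of the transition map. Its value at all
  other arguments is \<open>0\<close>, so that equality of tangent vectors is equality of functions.\<close>

type_synonym ('m, 'e) tangent = "('m, 'e) chart \<Rightarrow> 'e"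

definition charts_at :: "('m, 'e) chart set \<Rightarrow> 'm \<Rightarrow> ('m, 'e) chart set" where
  "charts_at A p = {c \<in> A. p \<in> fst c}"

definition tangent_space ::
  "('m, 'e::euclidean_space) chart set \<Rightarrow> 'm \<Rightarrow> ('m, 'e) tangent set" where
  "tangent_space A p =
     {v. (\<forall>c\<in>charts_at A p. \<forall>d\<in>charts_at A p.
            v d = frechet_derivative (snd d \<circ> chart_inv c) (at (snd c p)) (v c)) \<and>
         (\<forall>c. c \<notin> charts_at A p \<longrightarrow> v c = 0)}"

text \<open>The tangent vector at \<open>p\<close> whose coordinates in the chart \<open>c\<close> (around \<open>p\<close>) are \<open>w\<close>.\<close>

definition tangent_of ::
  "('m, 'e::euclidean_space) chart set \<Rightarrow> ('m, 'e) chart \<Rightarrow> 'm \<Rightarrow> 'e \<Rightarrow> ('m, 'e) tangent" where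
  "tangent_of A c p w =
     (\<lambda>d. if d \<in> charts_at A p
          then frechet_derivative (snd d \<circ> chart_inv c) (at (snd c p)) w else 0)"

definition lincomb ::
  "real \<Rightarrow> ('m, 'e::euclidean_space) tangent \<Rightarrow> real \<Rightarrow> ('m, 'e) tangent \<Rightarrow> ('m, 'e) tangent" where
  "lincomb a u b v = (\<lambda>c. a *\<^sub>R u c + b *\<^sub>R v c)"

definition vector_field ::
  "('m, 'e::euclidean_space) chart set \<Rightarrow> ('m \<Rightarrow> ('m, 'e) tangent) \<Rightarrow> bool" where
  "vector_field A X \<longleftrightarrow>
     (\<forall>p. X p \<in> tangent_space A p) \<and>
     (\<forall>c\<in>A. smooth_on (snd c ` fst c) (\<lambda>x. X (chart_inv c x) c))"

definition scale_field ::
  "('m \<Rightarrow> real) \<Rightarrow> ('m \<Rightarrow> ('m, 'e::euclidean_space) tangent) \<Rightarrow> 'm \<Rightarrow> ('m, 'e) tangent" where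
  "scale_field h X = (\<lambda>p c. h p *\<^sub>R X p c)"


section \<open>Exterior algebra\<close>

text \<open>A \<open>k\<close>-form on a vector space takes the list of its \<open>k\<close> arguments; its values on lists of other
  lengths are irrelevant. The wedge product of a \<open>k\<close>-form and an \<open>l\<close>-form is normalised such that
  \<open>dx\<^sub>1 \<and> \<dots> \<and> dx\<^sub>n\<close> is the determinant.\<close>

definition wedge ::
  "nat \<Rightarrow> nat \<Rightarrow> ('v list \<Rightarrow> real) \<Rightarrow> ('v list \<Rightarrow> real) \<Rightarrow> 'v list \<Rightarrow> real" where
  "wedge k l \<omega> \<eta> vs =
     (\<Sum>\<sigma> | \<sigma> permutes {..<k + l}.
        of_int (sign \<sigma>) * \<omega> (map (\<lambda>i. vs ! \<sigma> i) [0..<k]) * \<eta> (map (\<lambda>i. vs ! \<sigma> i) [k..<k + l]))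
     / (fact k * fact l)"

primrec wedge_power :: "nat \<Rightarrow> nat \<Rightarrow> ('v list \<Rightarrow> real) \<Rightarrow> 'v list \<Rightarrow> real" where
  "wedge_power k 0 \<omega> = (\<lambda>vs. 1)"
| "wedge_power k (Suc n) \<omega> = wedge k (k * n) \<omega> (wedge_power k n \<omega>)"


section \<open>Differential forms\<close>

type_synonym ('m, 'e) form = "'m \<Rightarrow> ('m, 'e) tangent list \<Rightarrow> real"

definition tangent_lists ::
  "('m, 'e::euclidean_space) chart set \<Rightarrow> nat \<Rightarrow> 'm \<Rightarrow> ('m, 'e) tangent list set" where
  "tangent_lists A k p = {vs. length vs = k \<and> set vs \<subseteq> tangent_space A p}"

definition multilinear_at ::
  "('m, 'e::euclidean_space) chart set \<Rightarrow> nat \<Rightarrow> 'm \<Rightarrow> (('m, 'e) tangent list \<Rightarrow> real) \<Rightarrow> bool" where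
  "multilinear_at A k p \<omega> \<longleftrightarrow>
     (\<forall>vs\<in>tangent_lists A k p. \<forall>u\<in>tangent_space A p. \<forall>v\<in>tangent_space A p. \<forall>i<k. \<forall>a b.
        \<omega> (vs[i := lincomb a u b v]) = a * \<omega> (vs[i := u]) + b * \<omega> (vs[i := v]))"

definition alternating_at ::
  "('m, 'e::euclidean_space) chart set \<Rightarrow> nat \<Rightarrow> 'm \<Rightarrow> (('m, 'e) tangent list \<Rightarrow> real) \<Rightarrow> bool" where
  "alternating_at A k p \<omega> \<longleftrightarrow>
     (\<forall>vs\<in>tangent_lists A k p. \<forall>i<k. \<forall>j<k. i \<noteq> j \<and> vs ! i = vs ! j \<longrightarrow> \<omega> vs = 0)"

text \<open>\<open>coord_form A c \<omega> ws\<close> is the function \<open>\<omega>(w\<^sub>1, \<dots>, w\<^sub>k)\<close> in the coordinates \<open>c\<close>, for constant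
  coordinate vectors \<open>ws\<close>.\<close>

definition coord_form ::
  "('m, 'e::euclidean_space) chart set \<Rightarrow> ('m, 'e) chart \<Rightarrow> ('m, 'e) form \<Rightarrow> 'e list \<Rightarrow> 'e \<Rightarrow> real"
  where
  "coord_form A c \<omega> ws = (\<lambda>x. \<omega> (chart_inv c x) (map (tangent_of A c (chart_inv c x)) ws))"

definition diff_form ::
  "('m, 'e::euclidean_space) chart set \<Rightarrow> nat \<Rightarrow> ('m, 'e) form \<Rightarrow> bool" where
  "diff_form A k \<omega> \<longleftrightarrow>
     (\<forall>p. multilinear_at A k p (\<omega> p) \<and> alternating_at A k p (\<omega> p)) \<and>
     (\<forall>c\<in>A. \<forall>ws. length ws = k \<longrightarrow> smooth_on (snd c ` fst c) (coord_form A c \<omega> ws))"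

definition form_eq ::
  "('m, 'e::euclidean_space) chart set \<Rightarrow> nat \<Rightarrow> ('m, 'e) form \<Rightarrow> ('m, 'e) form \<Rightarrow> bool" where
  "form_eq A k \<omega> \<eta> \<longleftrightarrow> (\<forall>p. \<forall>vs\<in>tangent_lists A k p. \<omega> p vs = \<eta> p vs)"

definition scale_form :: "('m \<Rightarrow> real) \<Rightarrow> ('m, 'e) form \<Rightarrow> ('m, 'e) form" where
  "scale_form g \<omega> = (\<lambda>p vs. g p * \<omega> p vs)"

definition interior_product :: "('m \<Rightarrow> ('m, 'e) tangent) \<Rightarrow> ('m, 'e) form \<Rightarrow> ('m, 'e) form" where
  "interior_product X \<omega> = (\<lambda>p vs. \<omega> p (X p # vs))"

text \<open>The exterior derivative of a \<open>k\<close>-form, by the usual coordinate formula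
  \<open>d\<omega>(v\<^sub>0, \<dots>, v\<^sub>k) = \<Sum>\<^sub>i (-1)\<^sup>i D\<omega>(v\<^sub>i)(v\<^sub>0, \<dots>, v\<^sub>i\<^sub>-\<^sub>1, v\<^sub>i\<^sub>+\<^sub>1, \<dots>, v\<^sub>k)\<close>
  in some chart around \<open>p\<close>; for differential forms the choice of chart does not matter.\<close>

definition ext_deriv ::
  "('m, 'e::euclidean_space) chart set \<Rightarrow> nat \<Rightarrow> ('m, 'e) form \<Rightarrow> ('m, 'e) form" where
  "ext_deriv A k \<omega> = (\<lambda>p vs.
     let c = (SOME c. c \<in> charts_at A p) in
       \<Sum>i\<le>k. (-1) ^ i *
         frechet_derivative
           (coord_form A c \<omega> (map (\<lambda>v. v c) (take i vs @ drop (Suc i) vs))) (at (snd c p))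
           ((vs ! i) c))"


section \<open>Contact structures\<close>

definition contact_form ::
  "('m, 'e::euclidean_space) chart set \<Rightarrow> ('m, 'e) form \<Rightarrow> bool" where
  "contact_form A \<alpha> \<longleftrightarrow> diff_form A 1 \<alpha> \<and>
     (\<exists>n. DIM('e) = 2 * n + 1 \<and>
       (\<forall>p. \<exists>vs\<in>tangent_lists A (2 * n + 1) p.
          wedge 1 (2 * n) (\<alpha> p) (wedge_power 2 n (ext_deriv A 1 \<alpha> p)) vs \<noteq> 0))"

definition contact_form_for ::
  "('m, 'e::euclidean_space) chart set \<Rightarrow> ('m \<Rightarrow> ('m, 'e) tangent set) \<Rightarrow> ('m, 'e) form \<Rightarrow> bool" where
  "contact_form_for A \<xi> \<alpha> \<longleftrightarrow>
     contact_form A \<alpha> \<and> (\<forall>p. \<xi> p = {v \<in> tangent_space A p. \<alpha> p [v] = 0})"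

definition cooriented_contact_structure ::
  "('m, 'e::euclidean_space) chart set \<Rightarrow> ('m \<Rightarrow> ('m, 'e) tangent set) \<Rightarrow> bool" where
  "cooriented_contact_structure A \<xi> \<longleftrightarrow> (\<exists>\<alpha>. contact_form_for A \<xi> \<alpha>)"

definition Reeb_field ::
  "('m, 'e::euclidean_space) chart set \<Rightarrow> ('m, 'e) form \<Rightarrow> ('m \<Rightarrow> ('m, 'e) tangent) \<Rightarrow> bool" where
  "Reeb_field A \<alpha> R \<longleftrightarrow> vector_field A R \<and>
     form_eq A 1 (interior_product R (ext_deriv A 1 \<alpha>)) (\<lambda>p vs. 0) \<and>
     (\<forall>p. \<alpha> p [R p] = 1)"


section \<open>\<open>G\<^sub>2\<close>-structures\<close>

text \<open>In the index type \<open>7\<close> the numerals \<open>1, \<dots>, 7\<close> are distinct and exhaust the type.\<close>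

definition dx :: "7 \<Rightarrow> (real^7) list \<Rightarrow> real" where
  "dx i vs = hd vs $ i"

definition dx3 :: "7 \<Rightarrow> 7 \<Rightarrow> 7 \<Rightarrow> (real^7) list \<Rightarrow> real" where
  "dx3 i j k = wedge 1 2 (dx i) (wedge 1 1 (dx j) (dx k))"

definition phi0 :: "(real^7) list \<Rightarrow> real" where
  "phi0 vs = dx3 1 2 3 vs + dx3 1 4 5 vs + dx3 1 6 7 vs + dx3 2 4 6 vs
           - dx3 2 5 7 vs - dx3 3 4 7 vs - dx3 3 5 6 vs"

definition linear_iso_at ::
  "('m, 'e::euclidean_space) chart set \<Rightarrow> 'm \<Rightarrow> (('m, 'e) tangent \<Rightarrow> real^7) \<Rightarrow> bool" where
  "linear_iso_at A p L \<longleftrightarrow> bij_betw L (tangent_space A p) UNIV \<and>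
     (\<forall>u\<in>tangent_space A p. \<forall>v\<in>tangent_space A p. \<forall>a b.
        L (lincomb a u b v) = a *\<^sub>R L u + b *\<^sub>R L v)"

definition G2_structure :: "('m, real^7) chart set \<Rightarrow> ('m, real^7) form \<Rightarrow> bool" where
  "G2_structure A \<phi> \<longleftrightarrow> diff_form A 3 \<phi> \<and>
     (\<forall>p. \<exists>L. linear_iso_at A p L \<and> (\<forall>vs\<in>tangent_lists A 3 p. \<phi> p vs = phi0 (map L vs)))"

definition contact_G2_structure ::
  "('m, real^7) chart set \<Rightarrow>
   ('m, real^7) form \<times> ('m \<Rightarrow> ('m, real^7) tangent) \<times> ('m, real^7) form \<times>
     ('m \<Rightarrow> real) \<times> ('m \<Rightarrow> real) \<Rightarrow> bool" where
  "contact_G2_structure A = (\<lambda>(\<phi>, R, \<alpha>, f, g).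
     G2_structure A \<phi> \<and>
     vector_field A R \<and> (\<forall>p. R p \<noteq> (\<lambda>c. 0)) \<and>
     diff_form A 1 \<alpha> \<and>
     smooth_function A f \<and> (\<forall>p. f p \<noteq> 0) \<and>
     smooth_function A g \<and> (\<forall>p. g p \<noteq> 0) \<and>
     (\<forall>p. \<alpha> p [R p] = f p) \<and>
     form_eq A 2 (ext_deriv A 1 (scale_form g \<alpha>)) (interior_product R \<phi>))"

text \<open>Smoothness of \<open>h\<close> is not demanded (it follows from that of \<open>R\<close> and \<open>h R\<close>).\<close>

definition A_compatible ::
  "('m, real^7) chart set \<Rightarrow> ('m, real^7) form \<Rightarrow> ('m \<Rightarrow> ('m, real^7) tangent set) \<Rightarrow> bool" where
  "A_compatible A \<phi> \<xi> \<longleftrightarrow> cooriented_contact_structure A \<xi> \<and>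
     (\<exists>R h. vector_field A R \<and> (\<forall>p. h p \<noteq> 0) \<and>
        (\<exists>\<alpha>. contact_form_for A \<xi> \<alpha> \<and> form_eq A 2 (ext_deriv A 1 \<alpha>) (interior_product R \<phi>)) \<and>
        (\<exists>\<beta>. contact_form_for A \<xi> \<beta> \<and> Reeb_field A \<beta> (scale_field h R)))"

end

theory Submission
  imports Defs
begin

text \<open>Take the contact form \<open>\<alpha>\<close> with \<open>d\<alpha> = \<iota>\<^sub>R \<phi>\<close>, and put \<open>g = 1\<close>, \<open>f = \<alpha>(R)\<close>. If \<open>h R\<close> is the
  Reeb field of \<open>\<beta>\<close>, then \<open>h \<beta>(R) = 1\<close>, so \<open>R\<close> is nowhere in \<open>ker \<beta> = \<xi> = ker \<alpha>\<close>, and hence \<open>f\<close>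
  and \<open>R\<close> vanish nowhere. Smoothness of \<open>f\<close> follows from its expansion
  \<open>f = \<Sum>\<^sub>b R\<^sub>b \<alpha>(\<partial>\<^sub>b)\<close> in coordinates.\<close>

section \<open>Calculus of smooth functions\<close>

text \<open>Derivatives at points of an open set are local, so \<open>f\<close> and \<open>g\<close>
  have the same \<open>has_derivative\<close> facts on \<open>S\<close>. As
  \<open>frechet_derivative\<close> is chosen from these facts alone, it agrees too, and the
  induction passes to the next order.\<close>

lemma C_on_cong:
  assumes "open S" "\<And>x. x \<in> S \<Longrightarrow> f x = g x"
  shows "C_on n S f \<longleftrightarrow> C_on n S g"
  using assms(2)
proof (induction n arbitrary: f g)
  case 0
  then show ?case by (simp cong: continuous_on_cong)
next
  case (Suc n)
  have imp: "(v has_derivative D) (at x)"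
    if "x \<in> S" "(u has_derivative D) (at x)" "\<And>y. y \<in> S \<Longrightarrow> u y = v y" for u v :: "'a \<Rightarrow> 'b" and D x
    using has_derivative_transform_within_open[OF that(2) \<open>open S\<close> that(1) that(3)] by simp
  have iff: "(f has_derivative D) (at x) \<longleftrightarrow> (g has_derivative D) (at x)" if "x \<in> S" for D x
    using imp[OF that, of f D g] imp[OF that, of g D f] Suc.prems by auto
  have "f differentiable (at x) \<longleftrightarrow> g differentiable (at x)" if "x \<in> S" for x
    using iff[OF that] by (simp add: differentiable_def)
  moreover have "frechet_derivative f (at x) v = frechet_derivative g (at x) v" if "x \<in> S" for x v
    using iff[OF that] by (simp add: frechet_derivative_def)
  ultimately show ?case
    using Suc.IH[of "\<lambda>x. frechet_derivative f (at x) v" "\<lambda>x. frechet_derivative g (at x) v" for v]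
    by simp
qed

lemma smooth_on_cong:
  assumes "open S" "\<And>x. x \<in> S \<Longrightarrow> f x = g x"
  shows "smooth_on S f \<longleftrightarrow> smooth_on S g"
  unfolding smooth_on_def using C_on_cong[of S f g] assms by blast

lemma smooth_on_imp_differentiable:
  assumes "smooth_on S f" "x \<in> S"
  shows "f differentiable (at x)"
  using assms unfolding smooth_on_def by (metis C_on.simps(2))

lemma smooth_on_frechet_derivative:
  assumes "smooth_on S f"
  shows "smooth_on S (\<lambda>x. frechet_derivative f (at x) v)"
  using assms unfolding smooth_on_def by (metis C_on.simps(2))

lemma smooth_on_const [simp]: "smooth_on S (\<lambda>x. c)"
proof -
  have "C_on n S (\<lambda>x. c)" for n
    by (induction n arbitrary: c) simp_all
  then show ?thesis
    by (simp add: smooth_on_def)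
qed

lemma C_on_add:
  assumes "open S" "C_on n S f" "C_on n S g"
  shows "C_on n S (\<lambda>x. f x + g x)"
  using assms(2,3)
proof (induction n arbitrary: f g)
  case 0
  then show ?case by (simp add: continuous_on_add)
next
  case (Suc n)
  have "C_on n S (\<lambda>x. frechet_derivative (\<lambda>x. f x + g x) (at x) v)" for v
  \<comment> \<open>The sum rule identifies the derivative only at points of \<open>S\<close>, hence
    the rewriting by congruence on \<open>S\<close>.\<close>
  proof (subst C_on_cong[OF \<open>open S\<close>])
    fix x assume "x \<in> S"
    then have "f differentiable (at x)" "g differentiable (at x)"
      using Suc.prems by auto
    then show "frechet_derivative (\<lambda>x. f x + g x) (at x) v
        = frechet_derivative f (at x) v + frechet_derivative g (at x) v"
      by (simp add: frechet_derivative_at[OF has_derivative_add, symmetric] frechet_derivative_works)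
  qed (use Suc in auto)
  then show ?case
    using Suc.prems by simp
qed

lemma smooth_on_sum:
  assumes "open S" "\<And>i. i \<in> I \<Longrightarrow> smooth_on S (f i)"
  shows "smooth_on S (\<lambda>x. \<Sum>i\<in>I. f i x)"
  using assms(2)
proof (induction I rule: infinite_finite_induct)
  case (insert i I)
  then have "C_on n S (\<lambda>x. f i x + (\<Sum>i\<in>I. f i x))" for n
    by (intro C_on_add \<open>open S\<close>) (simp_all add: smooth_on_def)
  with insert show ?case
    by (simp add: smooth_on_def)
qed simp_all

text \<open>The product rule involves each factor both differentiated and undifferentiated. Assuming
  \<open>smooth_on\<close> rather than \<open>C_on n\<close> in the induction makes the hypothesis
  available for both kinds of factor at once.\<close>

lemma (in bounded_bilinear) smooth_on:
  assumes "open S" "smooth_on S f" "smooth_on S g"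
  shows "smooth_on S (\<lambda>x. prod (f x) (g x))"
proof -
  have "C_on n S (\<lambda>x. prod (f x) (g x))" for n
    using assms(2,3)
  proof (induction n arbitrary: f g)
    case 0
    then have "C_on 0 S f" "C_on 0 S g"
      unfolding smooth_on_def by blast+
    then show ?case
      by (simp add: continuous_on)
  next
    case (Suc n)
    let ?D = "\<lambda>f x. frechet_derivative f (at x)"
    have D: "((\<lambda>x. prod (f x) (g x)) has_derivative
        (\<lambda>v. prod (f x) (?D g x v) + prod (?D f x v) (g x))) (at x)" if "x \<in> S" for x
      using smooth_on_imp_differentiable[OF Suc.prems(1) that]
        smooth_on_imp_differentiable[OF Suc.prems(2) that]
      by (intro FDERIV) (simp_all add: frechet_derivative_works)
    have "C_on n S (\<lambda>x. ?D (\<lambda>x. prod (f x) (g x)) x v)" for v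
    proof (subst C_on_cong[OF \<open>open S\<close>])
      show "?D (\<lambda>x. prod (f x) (g x)) x v = prod (f x) (?D g x v) + prod (?D f x v) (g x)"
        if "x \<in> S" for x
        by (simp add: frechet_derivative_at[OF D[OF that], symmetric])
      show "C_on n S (\<lambda>x. prod (f x) (?D g x v) + prod (?D f x v) (g x))"
        by (intro C_on_add \<open>open S\<close> Suc.IH smooth_on_frechet_derivative Suc.prems)
    qed
    then show ?case
      using D by (auto simp: differentiable_def)
  qed
  then show ?thesis
    by (simp add: smooth_on_def)
qed


section \<open>Coordinates of tangent vectors\<close>

lemma atlas_chart:
  assumes "smooth_atlas A" "c \<in> A"
  shows "open (fst c)" "open (snd c ` fst c)"
    "homeomorphism (fst c) (snd c ` fst c) (snd c) (chart_inv c)"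
  using assms unfolding smooth_atlas_def by auto

lemma chart_inv_left:
  assumes "smooth_atlas A" "c \<in> A" "p \<in> fst c"
  shows "chart_inv c (snd c p) = p"
  using atlas_chart(3)[OF assms(1,2)] assms(3) by (simp add: homeomorphism_def)

lemma chart_inv_in:
  assumes "x \<in> snd c ` fst c"
  shows "chart_inv c x \<in> fst c" "snd c (chart_inv c x) = x"
  using assms unfolding chart_inv_def by (auto intro: inv_into_into f_inv_into_f)

text \<open>The set is the preimage of \<open>fst d\<close> under the continuous map
  \<open>chart_inv c\<close>. Its openness lets derivatives of transition maps be compared
  there.\<close>

lemma open_chart_overlap:
  assumes "smooth_atlas A" "c \<in> A" "d \<in> A"
  shows "open (snd c ` (fst c \<inter> fst d))"
proof -
  have "snd c ` (fst c \<inter> fst d) = snd c ` fst c \<inter> chart_inv c -` fst d"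
    using chart_inv_left[OF assms(1,2)] by force
  moreover have "continuous_on (snd c ` fst c) (chart_inv c)"
    using atlas_chart(3)[OF assms(1,2)] by (simp add: homeomorphism_def)
  ultimately show ?thesis
    using atlas_chart[OF assms(1,2)] atlas_chart(1)[OF assms(1,3)]
    by (metis Int_commute continuous_on_open_vimage)
qed

lemma transition_differentiable:
  assumes "smooth_atlas A" "c \<in> charts_at A p" "d \<in> charts_at A p"
  shows "(snd d \<circ> chart_inv c) differentiable (at (snd c p))"
  using assms smooth_on_imp_differentiable unfolding smooth_atlas_def charts_at_def by blast

text \<open>This is the cocycle rule for derivatives of transition maps: the chain rule applied to
  the passage from \<open>c\<close> through \<open>d\<close> to \<open>e\<close>.\<close>

lemma tangent_of_in_tangent_space:
  assumes "smooth_atlas A" "c \<in> charts_at A p"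
  shows "tangent_of A c p w \<in> tangent_space A p"
proof -
  have "frechet_derivative (snd e \<circ> chart_inv c) (at (snd c p)) w
      = frechet_derivative (snd e \<circ> chart_inv d) (at (snd d p))
          (frechet_derivative (snd d \<circ> chart_inv c) (at (snd c p)) w)"
    if de: "d \<in> charts_at A p" "e \<in> charts_at A p" for d e
  proof -
    let ?S = "snd c ` (fst c \<inter> fst d)"
    have A: "c \<in> A" "d \<in> A" "p \<in> fst c" "p \<in> fst d"
      using assms(2) de unfolding charts_at_def by auto
    have p: "(snd d \<circ> chart_inv c) (snd c p) = snd d p"
      using chart_inv_left[OF assms(1) A(1,3)] by simp
    have "(snd d \<circ> chart_inv c has_derivative frechet_derivative (snd d \<circ> chart_inv c) (at (snd c p)))
        (at (snd c p))"
      using transition_differentiable[OF assms de(1)] frechet_derivative_works by blast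
    moreover have "(snd e \<circ> chart_inv d has_derivative
        frechet_derivative (snd e \<circ> chart_inv d) (at (snd d p))) (at ((snd d \<circ> chart_inv c) (snd c p)))"
      using transition_differentiable[OF assms(1) de] frechet_derivative_works p by metis
    ultimately have "((snd e \<circ> chart_inv d) \<circ> (snd d \<circ> chart_inv c) has_derivative
        frechet_derivative (snd e \<circ> chart_inv d) (at (snd d p)) \<circ>
        frechet_derivative (snd d \<circ> chart_inv c) (at (snd c p))) (at (snd c p))"
      by (rule diff_chain_at)
    \<comment> \<open>The composite through \<open>d\<close> equals the direct transition only where
      \<open>chart_inv c\<close> lands in \<open>fst d\<close>; this is a neighbourhood of
      \<open>snd c p\<close>, which suffices for the derivative.\<close>
    moreover have "((snd e \<circ> chart_inv d) \<circ> (snd d \<circ> chart_inv c)) x = (snd e \<circ> chart_inv c) x"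
      if "x \<in> ?S" for x
      using that chart_inv_left[OF assms(1) A(1)] chart_inv_left[OF assms(1) A(2)] by auto
    moreover have "snd c p \<in> ?S"
      using A by blast
    ultimately have "(snd e \<circ> chart_inv c has_derivative
        frechet_derivative (snd e \<circ> chart_inv d) (at (snd d p)) \<circ>
        frechet_derivative (snd d \<circ> chart_inv c) (at (snd c p))) (at (snd c p))"
      using has_derivative_transform_within_open[OF _ open_chart_overlap[OF assms(1) A(1,2)]]
      by blast
    from frechet_derivative_at[OF this, symmetric] show ?thesis
      by simp
  qed
  note cocycle = this
  show ?thesis
    unfolding tangent_space_def tangent_of_def by (auto intro: cocycle)
qed

text \<open>Shows that \<open>tangent_of A c p\<close> reaches every tangent vector, so one-forms
  can be evaluated through coordinates in a single chart.\<close>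

lemma tangent_of_coordinates:
  assumes "c \<in> charts_at A p" "v \<in> tangent_space A p"
  shows "tangent_of A c p (v c) = v"
proof
  fix d
  have "v d = frechet_derivative (snd d \<circ> chart_inv c) (at (snd c p)) (v c)" if "d \<in> charts_at A p"
    using assms that unfolding tangent_space_def by blast
  moreover have "v d = 0" if "d \<notin> charts_at A p"
    using assms(2) that unfolding tangent_space_def by blast
  ultimately show "tangent_of A c p (v c) d = v d"
    by (auto simp: tangent_of_def)
qed

lemma tangent_of_linear:
  assumes "smooth_atlas A" "c \<in> charts_at A p"
  shows "tangent_of A c p (a *\<^sub>R u + b *\<^sub>R v) = lincomb a (tangent_of A c p u) b (tangent_of A c p v)"
proof -
  have "linear (frechet_derivative (snd d \<circ> chart_inv c) (at (snd c p)))" if "d \<in> charts_at A p" for d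
    using linear_frechet_derivative[OF transition_differentiable[OF assms that]] .
  then show ?thesis
    by (auto simp: tangent_of_def lincomb_def linear_add linear_scale)
qed

section \<open>One-forms evaluated on tangent vectors and vector fields\<close>

lemma one_form_lincomb:
  assumes "diff_form A 1 \<alpha>" "u \<in> tangent_space A p" "v \<in> tangent_space A p"
  shows "\<alpha> p [lincomb a u b v] = a * \<alpha> p [u] + b * \<alpha> p [v]"
proof -
  have "multilinear_at A 1 p (\<alpha> p)"
    using assms(1) by (simp add: diff_form_def)
  \<comment> \<open>The list \<open>[u]\<close> is a placeholder: its only entry is overwritten in
    each term of multilinearity.\<close>
  moreover have "[u] \<in> tangent_lists A 1 p"
    using assms(2) by (simp add: tangent_lists_def)
  ultimately have "\<alpha> p ([u][0 := lincomb a u b v]) = a * \<alpha> p ([u][0 := u]) + b * \<alpha> p ([u][0 := v])"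
    using assms(2,3) zero_less_one unfolding multilinear_at_def by blast
  then show ?thesis
    by simp
qed

text \<open>Serves to pull \<open>h\<close> out of the Reeb normalisation and, with
  \<open>a = 0\<close>, to see that a one-form vanishes on the zero vector.\<close>

lemma one_form_scaleR:
  assumes "diff_form A 1 \<alpha>" "v \<in> tangent_space A p"
  shows "\<alpha> p [\<lambda>c. a *\<^sub>R v c] = a * \<alpha> p [v]"
  using one_form_lincomb[OF assms(1,2,2), of a 0] by (simp add: lincomb_def)

text \<open>Composing \<alpha> with \<open>tangent_of A c p\<close> gives a linear functional on the
  coordinate space, applied here to the basis expansion of \<open>v c\<close>.\<close>

lemma one_form_expansion:
  assumes "smooth_atlas A" "diff_form A 1 \<alpha>" "c \<in> charts_at A p" "v \<in> tangent_space A p"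
  shows "\<alpha> p [v] = (\<Sum>b\<in>Basis. (v c \<bullet> b) * \<alpha> p [tangent_of A c p b])"
proof -
  have lin: "\<alpha> p [tangent_of A c p (a *\<^sub>R x + b *\<^sub>R y)]
      = a * \<alpha> p [tangent_of A c p x] + b * \<alpha> p [tangent_of A c p y]" for a b x y
    using assms tangent_of_linear one_form_lincomb tangent_of_in_tangent_space by metis
  have "linear (\<lambda>w. \<alpha> p [tangent_of A c p w])"
    \<comment> \<open>Coefficients \<open>a = b = 1\<close> give additivity; \<open>b = 0\<close>,
      \<open>y = 0\<close> give homogeneity.\<close>
    using lin[of 1 _ 1] lin[of _ _ 0 0] by (intro linearI) simp_all
  then have "\<alpha> p [tangent_of A c p (\<Sum>b\<in>Basis. (v c \<bullet> b) *\<^sub>R b)]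
      = (\<Sum>b\<in>Basis. (v c \<bullet> b) * \<alpha> p [tangent_of A c p b])"
    by (simp add: linear_sum[of "\<lambda>w. \<alpha> p [tangent_of A c p w]"]
        linear_scale[of "\<lambda>w. \<alpha> p [tangent_of A c p w]"])
  then show ?thesis
    using tangent_of_coordinates[OF assms(3,4)] by (simp add: euclidean_representation)
qed

lemma smooth_function_one_form:
  assumes "smooth_atlas A" "diff_form A 1 \<alpha>" "vector_field A X"
  shows "smooth_function A (\<lambda>p. \<alpha> p [X p])"
  unfolding smooth_function_def
proof
  fix c assume c: "c \<in> A"
  note S = atlas_chart(2)[OF assms(1) c]
  have eq: "((\<lambda>p. \<alpha> p [X p]) \<circ> chart_inv c) x
      = (\<Sum>b\<in>Basis. (X (chart_inv c x) c \<bullet> b) * coord_form A c \<alpha> [b] x)"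
    if "x \<in> snd c ` fst c" for x
  proof -
    have "c \<in> charts_at A (chart_inv c x)"
      using chart_inv_in(1)[OF that] c by (simp add: charts_at_def)
    then show ?thesis
      using one_form_expansion[OF assms(1,2), of c "chart_inv c x" "X (chart_inv c x)"] assms(3)
      by (simp add: vector_field_def coord_form_def)
  qed
  have "smooth_on (snd c ` fst c)
      (\<lambda>x. \<Sum>b\<in>Basis. (X (chart_inv c x) c \<bullet> b) * coord_form A c \<alpha> [b] x)"
  \<comment> \<open>The bilinear rule is used twice: for the products, and for the components of
    \<open>X\<close> as inner products with the constant \<open>b\<close>.\<close>
  proof (intro smooth_on_sum bounded_bilinear.smooth_on[OF bounded_bilinear_mult]
      bounded_bilinear.smooth_on[OF bounded_bilinear_inner] smooth_on_const S)
    show "smooth_on (snd c ` fst c) (\<lambda>x. X (chart_inv c x) c)"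
      using assms(3) c by (simp add: vector_field_def)
    show "smooth_on (snd c ` fst c) (coord_form A c \<alpha> [b])" for b
      using assms(2) c by (simp add: diff_form_def)
  qed
  then show "smooth_on (snd c ` fst c) ((\<lambda>p. \<alpha> p [X p]) \<circ> chart_inv c)"
    by (subst smooth_on_cong[OF S eq])
qed

theorem theorem6p4:
  fixes A :: "('m::{t2_space, second_countable_topology}, real^7) chart set"
    and \<phi> :: "('m, real^7) form"
    and \<xi> :: "'m \<Rightarrow> ('m, real^7) tangent set"
  assumes "smooth_atlas A"
    and "G2_structure A \<phi>"
    and "A_compatible A \<phi> \<xi>"
  shows "\<exists>R \<alpha> f g. contact_G2_structure A (\<phi>, R, \<alpha>, f, g) \<and> contact_form_for A \<xi> \<alpha>"
proof -
  from assms(3) obtain R h \<alpha> \<beta> where R: "vector_field A R"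
    and \<alpha>: "contact_form_for A \<xi> \<alpha>"
    and d\<alpha>: "form_eq A 2 (ext_deriv A 1 \<alpha>) (interior_product R \<phi>)"
    and \<beta>: "contact_form_for A \<xi> \<beta>" and Reeb: "Reeb_field A \<beta> (scale_field h R)"
    unfolding A_compatible_def by blast
  have Rp: "R p \<in> tangent_space A p" for p
    using R by (simp add: vector_field_def)
  have \<alpha>1: "diff_form A 1 \<alpha>" and \<beta>1: "diff_form A 1 \<beta>"
    using \<alpha> \<beta> by (simp_all add: contact_form_for_def contact_form_def)
  have f: "\<alpha> p [R p] \<noteq> 0" for p
  proof -
    \<comment> \<open>This is the normalisation of the Reeb field \<open>h R\<close> of
      \<beta>.\<close>
    have "h p * \<beta> p [R p] = 1"
      using Reeb one_form_scaleR[OF \<beta>1 Rp] by (simp add: Reeb_field_def scale_field_def)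
    then have "R p \<notin> \<xi> p"
      using \<beta> by (auto simp: contact_form_for_def)
    then show ?thesis
      using \<alpha> Rp by (auto simp: contact_form_for_def)
  qed
  have "R p \<noteq> (\<lambda>c. 0)" for p
    using f[of p] one_form_scaleR[OF \<alpha>1 Rp, of p 0] by auto
  \<comment> \<open>With \<open>g = 1\<close> the scaled form is \<alpha> itself, so condition (ii)
    is exactly \<open>d\<alpha>\<close>.\<close>
  then have "contact_G2_structure A (\<phi>, R, \<alpha>, \<lambda>p. \<alpha> p [R p], \<lambda>p. 1)"
    using assms(2) R \<alpha>1 f d\<alpha> smooth_function_one_form[OF assms(1) \<alpha>1 R]
    by (simp add: contact_G2_structure_def scale_form_def smooth_function_def comp_def)
  then show ?thesis
    using \<alpha> by blast
qed

end
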